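(* If $G$ is a simple group, then $G$ has no non-trivial set-direct factorization.
   Context: Groups may be infinite. A subset of a group $G$ is normal if it is invariant under conjugation by all elements of $G$. A set-direct factorization $G=X\times Y$ consists of non-empty normal subsets $X,Y$ of $G$ such that every $g\in G$ has a unique representation $g=xy$ with $x\in X$ and $y\in Y$. A set-direct factorization $G=X\times Y$ is called non-trivial if and only if none of $X$ or $Y$ is a singleton consisting of a central element of $G$. *)

theory Defs
  imports "HOL-Algebra.SimpleGroups"
begin

text \<open>The library locale \<^locale>\<open>simple_group\<close> requires \<open>order G > 1\<close>, which excludes
  infinite groups, since \<open>order G = 0\<close> for these. The notion below also covers infinite groups;
  on finite groups both agree.\<close>

definition is_simple :: "('a, 'b) monoid_scheme \<Rightarrow> bool" where
  "is_simple G \<longleftrightarrow> group G \<and> carrier G \<noteq> {\<one>\<^bsub>G\<^esub>} \<and>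
     (\<forall>H. H \<lhd> G \<longrightarrow> H = carrier G \<or> H = {\<one>\<^bsub>G\<^esub>})"

lemma simple_group_iff_is_simple_finite:
  "simple_group G \<longleftrightarrow> is_simple G \<and> finite (carrier G)"
proof
  assume "simple_group G"
  then interpret simple_group G .
  have "finite (carrier G)"
    using order_gt_one order_gt_0_iff_finite by linarith
  then show "is_simple G \<and> finite (carrier G)"
    using simple_not_triv no_real_normal_subgroup is_group by (auto simp: is_simple_def)
next
  assume *: "is_simple G \<and> finite (carrier G)"
  then interpret group G by (simp add: is_simple_def)
  have "order G \<noteq> 1"
    using * one_closed unfolding is_simple_def order_def
    by (metis One_nat_def card_1_singletonE singletonD)
  moreover have "order G > 0"
    using * order_gt_0_iff_finite by blast
  ultimately show "simple_group G"
    using * by unfold_locales (auto simp: is_simple_def)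
qed

definition normal_subset :: "'a set \<Rightarrow> ('a, 'b) monoid_scheme \<Rightarrow> bool" where
  "normal_subset X G \<longleftrightarrow> X \<subseteq> carrier G \<and>
     (\<forall>g \<in> carrier G. \<forall>x \<in> X. g \<otimes>\<^bsub>G\<^esub> x \<otimes>\<^bsub>G\<^esub> inv\<^bsub>G\<^esub> g \<in> X)"

definition center :: "('a, 'b) monoid_scheme \<Rightarrow> 'a set" where
  "center G = {z \<in> carrier G. \<forall>g \<in> carrier G. z \<otimes>\<^bsub>G\<^esub> g = g \<otimes>\<^bsub>G\<^esub> z}"

definition set_direct_factorization ::
    "('a, 'b) monoid_scheme \<Rightarrow> 'a set \<Rightarrow> 'a set \<Rightarrow> bool" where
  "set_direct_factorization G X Y \<longleftrightarrow>
     X \<noteq> {} \<and> Y \<noteq> {} \<and> normal_subset X G \<and> normal_subset Y G \<and>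
     (\<forall>g \<in> carrier G. \<exists>!p. p \<in> X \<times> Y \<and> g = fst p \<otimes>\<^bsub>G\<^esub> snd p)"

definition nontrivial_set_direct_factorization ::
    "('a, 'b) monoid_scheme \<Rightarrow> 'a set \<Rightarrow> 'a set \<Rightarrow> bool" where
  "nontrivial_set_direct_factorization G X Y \<longleftrightarrow>
     set_direct_factorization G X Y \<and>
     \<not> (\<exists>z \<in> center G. X = {z}) \<and> \<not> (\<exists>z \<in> center G. Y = {z})"

end

theory Submission
  imports Defs "HOL-Algebra.Multiplicative_Group"
begin

text \<open>If \<open>G = X \<times> Y\<close> is a set-direct factorization and \<open>g\<close> commutes with \<open>x \<otimes> y\<close>, then
  conjugation by \<open>g\<close> yields another factorization of \<open>x \<otimes> y\<close>, so by uniqueness \<open>g\<close> commutes with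
  \<open>x\<close> and with \<open>y\<close>. For \<open>g = x \<otimes> y\<close> this shows that \<open>X\<close> and \<open>Y\<close> commute elementwise.
  The centralizer of the normal subset \<open>Y\<close> is a normal subgroup containing \<open>X\<close>; in a simple group
  it is trivial, and then \<open>X\<close> is a trivial factor, or it is all of \<open>G\<close>, and then \<open>Y\<close> is central.
  By symmetry only the case that \<open>G\<close> is abelian remains. Then \<open>G\<close> has prime order
  \<open>card X * card Y\<close>, so that one of the factors is a singleton.\<close>

definition centralizer :: "('a, 'b) monoid_scheme \<Rightarrow> 'a set \<Rightarrow> 'a set" where
  "centralizer G S = {g \<in> carrier G. \<forall>s \<in> S. g \<otimes>\<^bsub>G\<^esub> s = s \<otimes>\<^bsub>G\<^esub> g}"

context group
begin

lemma conjugate_eq_iff_commute: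
  assumes "g \<in> carrier G" "x \<in> carrier G"
  shows "g \<otimes> x \<otimes> inv g = x \<longleftrightarrow> g \<otimes> x = x \<otimes> g"
  using assms by (metis inv_solve_right m_closed)

text \<open>With products nested to the right by \<open>m_assoc\<close>, an element meets its
  inverse in exactly these two patterns; \<open>simp\<close> needs both to cancel inside longer
  products.\<close>

lemma inv_mult_cancel_left:
  assumes "g \<in> carrier G" "x \<in> carrier G"
  shows "inv g \<otimes> (g \<otimes> x) = x" "g \<otimes> (inv g \<otimes> x) = x"
  using assms by (simp_all flip: m_assoc)

lemma subgroup_centralizer:
  assumes "S \<subseteq> carrier G"
  shows "subgroup (centralizer G S) G"
proof
  show "centralizer G S \<subseteq> carrier G" "\<one> \<in> centralizer G S"
    using assms by (auto simp: centralizer_def)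
next
  fix g h assume "g \<in> centralizer G S" "h \<in> centralizer G S"
  then show "g \<otimes> h \<in> centralizer G S"
    using assms by (auto simp: centralizer_def subset_iff) (metis m_assoc)
next
  fix g assume g: "g \<in> centralizer G S"
  have "inv g \<otimes> s = s \<otimes> inv g" if "s \<in> S" for s
  proof -
    have s: "s \<in> carrier G" "g \<in> carrier G" "g \<otimes> s = s \<otimes> g"
      using that g assms by (auto simp: centralizer_def)
    then have "g \<otimes> s \<otimes> inv g = s"
      using conjugate_eq_iff_commute by blast
    then have "inv g \<otimes> s = inv g \<otimes> (g \<otimes> s \<otimes> inv g)"
      by simp
    also have "\<dots> = s \<otimes> inv g"
      using s(1,2) by (simp add: m_assoc inv_mult_cancel_left)
    finally show ?thesis .
  qed
  then show "inv g \<in> centralizer G S"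
    using g by (auto simp: centralizer_def)
qed

lemma normal_centralizer:
  assumes "normal_subset S G"
  shows "centralizer G S \<lhd> G"
proof (rule normal_invI)
  have S: "S \<subseteq> carrier G"
    using assms by (simp add: normal_subset_def)
  then show "subgroup (centralizer G S) G"
    by (rule subgroup_centralizer)
  fix g h assume g: "g \<in> carrier G" and h: "h \<in> centralizer G S"
  have "g \<otimes> h \<otimes> inv g \<otimes> s = s \<otimes> (g \<otimes> h \<otimes> inv g)" if "s \<in> S" for s
  proof -
    have c: "s \<in> carrier G" "h \<in> carrier G"
      using that h S by (auto simp: centralizer_def)
    \<comment> \<open>Commuting of \<open>g \<otimes> h \<otimes> inv g\<close> with
      \<open>s\<close> is commuting of \<open>h\<close> with this conjugate of \<open>s\<close>,
      which normality of \<open>S\<close> keeps inside \<open>S\<close>.\<close>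
    define t where "t = inv g \<otimes> s \<otimes> g"
    have "inv g \<otimes> s \<otimes> inv (inv g) \<in> S"
      using assms that g unfolding normal_subset_def by blast
    then have "t \<in> S"
      using g by (simp add: t_def)
    then have t: "t \<in> carrier G" "h \<otimes> t = t \<otimes> h"
      using h S by (auto simp: centralizer_def)
    have s: "s = g \<otimes> t \<otimes> inv g"
      using g c by (simp add: t_def m_assoc inv_mult_cancel_left)
    have "g \<otimes> h \<otimes> inv g \<otimes> s = g \<otimes> (h \<otimes> t) \<otimes> inv g"
      using g c t(1) by (simp add: s m_assoc inv_mult_cancel_left)
    also have "\<dots> = s \<otimes> (g \<otimes> h \<otimes> inv g)"
      unfolding t(2) using g c t(1) by (simp add: s m_assoc inv_mult_cancel_left)
    finally show ?thesis .
  qed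
  then show "g \<otimes> h \<otimes> inv g \<in> centralizer G S"
    using g h by (auto simp: centralizer_def)
qed

lemma set_direct_factorization_unique:
  assumes "set_direct_factorization G X Y"
    and "x \<in> X" "y \<in> Y" "x' \<in> X" "y' \<in> Y" "x \<otimes> y = x' \<otimes> y'"
  shows "x = x'" "y = y'"
proof -
  have "x \<otimes> y \<in> carrier G"
    using assms by (auto simp: set_direct_factorization_def normal_subset_def)
  then have "\<exists>!p. p \<in> X \<times> Y \<and> x \<otimes> y = fst p \<otimes> snd p"
    using assms(1) by (simp add: set_direct_factorization_def)
  moreover have "(x, y) \<in> X \<times> Y \<and> x \<otimes> y = fst (x, y) \<otimes> snd (x, y)"
    "(x', y') \<in> X \<times> Y \<and> x \<otimes> y = fst (x', y') \<otimes> snd (x', y')"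
    using assms by auto
  ultimately have "(x, y) = (x', y')"
    by blast
  then show "x = x'" "y = y'"
    by auto
qed

lemma bij_betw_set_direct_factorization:
  assumes "set_direct_factorization G X Y"
  shows "bij_betw (\<lambda>(x, y). x \<otimes> y) (X \<times> Y) (carrier G)"
proof (rule bij_betw_imageI)
  show "inj_on (\<lambda>(x, y). x \<otimes> y) (X \<times> Y)"
  proof (rule inj_onI)
    fix p q assume "p \<in> X \<times> Y" "q \<in> X \<times> Y"
      "(case p of (x, y) \<Rightarrow> x \<otimes> y) = (case q of (x, y) \<Rightarrow> x \<otimes> y)"
    then have "fst p \<in> X" "snd p \<in> Y" "fst q \<in> X" "snd q \<in> Y"
      "fst p \<otimes> snd p = fst q \<otimes> snd q"
      by (auto simp: case_prod_beta)
    then show "p = q"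
      using set_direct_factorization_unique[OF assms] by (intro prod_eqI)
  qed
  show "(\<lambda>(x, y). x \<otimes> y) ` (X \<times> Y) = carrier G"
  proof (intro equalityI subsetI)
    fix g assume "g \<in> carrier G"
    then obtain p where "p \<in> X \<times> Y" "g = fst p \<otimes> snd p"
      using assms unfolding set_direct_factorization_def by blast
    then show "g \<in> (\<lambda>(x, y). x \<otimes> y) ` (X \<times> Y)"
      by (simp add: case_prod_beta)
  qed (use assms in \<open>auto simp: set_direct_factorization_def normal_subset_def\<close>)
qed

text \<open>This also covers infinite groups: then \<open>X\<close> or \<open>Y\<close> is infinite,
  and both sides are 0.\<close>

lemma order_eq_set_direct_factorization:
  assumes "set_direct_factorization G X Y"
  shows "order G = card X * card Y"
  using bij_betw_same_card[OF bij_betw_set_direct_factorization[OF assms]]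
  by (simp add: order_def card_cartesian_product)

lemma set_direct_factorization_commute:
  assumes "set_direct_factorization G X Y" "x \<in> X" "y \<in> Y"
  shows "x \<otimes> y = y \<otimes> x"
proof -
  have c: "x \<in> carrier G" "y \<in> carrier G"
    using assms by (auto simp: set_direct_factorization_def normal_subset_def)
  define g where "g = x \<otimes> y"
  have g: "g \<in> carrier G"
    using c by (simp add: g_def)
  have "g \<otimes> x \<otimes> inv g \<in> X" "g \<otimes> y \<otimes> inv g \<in> Y"
    using assms g by (auto simp: set_direct_factorization_def normal_subset_def)
  moreover have "x \<otimes> y = (g \<otimes> x \<otimes> inv g) \<otimes> (g \<otimes> y \<otimes> inv g)"
  proof -
    have "(g \<otimes> x \<otimes> inv g) \<otimes> (g \<otimes> y \<otimes> inv g) = g \<otimes> (x \<otimes> y) \<otimes> inv g"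
      using c g by (simp add: m_assoc inv_mult_cancel_left)
    \<comment> \<open>Folding \<open>x \<otimes> y\<close> into \<open>g\<close> leaves
      \<open>g\<close> conjugated by itself.\<close>
    also have "\<dots> = x \<otimes> y"
      using g unfolding g_def[symmetric] by (simp add: m_assoc)
    finally show ?thesis ..
  qed
  ultimately have "x = g \<otimes> x \<otimes> inv g"
    using set_direct_factorization_unique(1) assms by blast
  \<comment> \<open>Commuting of \<open>g\<close> with \<open>x\<close>, written out; cancelling
    \<open>x\<close> on the left gives the claim.\<close>
  then have "x \<otimes> y \<otimes> x = x \<otimes> (x \<otimes> y)"
    using conjugate_eq_iff_commute[OF g c(1)] by (simp add: g_def)
  then show ?thesis
    using c by (simp add: m_assoc)
qed

text \<open>Only \<open>Y\<close> has to be normal, since only its centralizer is formed. The two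
  factors can thus be inserted in either order.\<close>

lemma is_simple_central_or_trivial:
  assumes "is_simple G" "normal_subset Y G"
    and "X \<subseteq> carrier G" "X \<noteq> {}" "\<And>x y. x \<in> X \<Longrightarrow> y \<in> Y \<Longrightarrow> x \<otimes> y = y \<otimes> x"
  shows "X = {\<one>} \<or> Y \<subseteq> center G"
proof -
  have X: "X \<subseteq> centralizer G Y"
    using assms(3,5) unfolding centralizer_def by blast
  have "centralizer G Y = carrier G \<or> centralizer G Y = {\<one>}"
    using assms(1) normal_centralizer[OF assms(2)] by (simp add: is_simple_def)
  then show ?thesis
  proof
    assume *: "centralizer G Y = carrier G"
    have "y \<in> center G" if "y \<in> Y" for y
    proof -
      have "g \<otimes> y = y \<otimes> g" if "g \<in> carrier G" for g
      proof -
        have "g \<in> centralizer G Y"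
          using that * by simp
        then show ?thesis
          using \<open>y \<in> Y\<close> by (simp add: centralizer_def)
      qed
      moreover have "y \<in> carrier G"
        using assms(2) \<open>y \<in> Y\<close> by (auto simp: normal_subset_def)
      ultimately show ?thesis
        by (simp add: center_def)
    qed
    then have "Y \<subseteq> center G" ..
    then show ?thesis ..
  next
    assume "centralizer G Y = {\<one>}"
    then show ?thesis
      using X assms(4) by (simp add: subset_singleton_iff)
  qed
qed

end

text \<open>Subgroups of an abelian group are normal, so by simplicity every element other than
  \<open>\<one>\<close> generates the group. Finiteness is part of the conclusion.\<close>

lemma (in comm_group) prime_order_if_is_simple:
  assumes "is_simple G"
  shows "prime (order G)"
proof -
  obtain g where g: "g \<in> carrier G" "g \<noteq> \<one>"
    using assms one_closed by (auto simp: is_simple_def)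
  have gen: "generate G {h} = carrier G" if h: "h \<in> carrier G" "h \<noteq> \<one>" for h
  proof -
    have "generate G {h} \<lhd> G"
      using h by (simp add: generate_is_subgroup subgroup_imp_normal)
    moreover have "h \<in> generate G {h}"
      by (simp add: generate.incl)
    ultimately show ?thesis
      using assms h(2) by (auto simp: is_simple_def)
  qed
  have ord: "ord h = order G" if "h \<in> carrier G" "h \<noteq> \<one>" for h
    using that by (simp add: generate_pow_card gen order_def)
  \<comment> \<open>The value 0 encodes an infinite group. There \<open>g\<close> has infinite
    order, so its square is a generator too, and \<open>g\<close> would be an even power of
    itself.\<close>
  have pos: "order G \<noteq> 0"
  proof
    assume "order G = 0"
    then have ord0: "ord g = 0"
      using ord g by simp
    then have "g [^] (2::int) \<noteq> \<one>"
      using int_pow_eq_id[OF g(1)] by simp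
    then have "g \<in> generate G {g [^] (2::int)}"
      using gen g by simp
    then obtain k :: int where "g = (g [^] (2::int)) [^] k"
      using generate_pow[of "g [^] (2::int)"] g by auto
    then have "g [^] (1::int) = g [^] (2 * k)"
      using g by (simp add: int_pow_pow)
    then have "2 * k - 1 = 0"
      using int_pow_eq[OF g(1)] ord0 by simp
    then show False
      by presburger
  qed
  show ?thesis
    unfolding prime_nat_iff
  proof (intro conjI allI impI)
    have "ord g \<noteq> 1"
      using g ord_eq_1 by blast
    then show "1 < order G"
      using pos ord[OF g] by simp
  next
    fix k assume k: "k dvd order G"
    then have "k \<noteq> 0"
      using pos by auto
    then have ordk: "ord (g [^] k) = order G div k"
      using k g ord by (simp add: ord_pow_gen gcd_nat.absorb2)
    \<comment> \<open>Either the power is trivial and \<open>order G\<close> divides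
      \<open>k\<close>, or it generates the group and has full order, which forces
      \<open>k = 1\<close>.\<close>
    show "k = 1 \<or> k = order G"
    proof (cases "g [^] k = \<one>")
      case True
      then have "order G dvd k"
        using g ord pow_eq_id by metis
      then show ?thesis
        using k dvd_antisym by blast
    next
      case False
      then have "order G div k = order G"
        using ordk ord g by simp
      then show ?thesis
        using pos by (simp add: div_eq_dividend_iff)
    qed
  qed
qed

theorem corollary1p3:
  fixes G :: "('a, 'b) monoid_scheme"
  assumes "is_simple G"
  shows "\<not> (\<exists>X Y. nontrivial_set_direct_factorization G X Y)"
proof
  assume "\<exists>X Y. nontrivial_set_direct_factorization G X Y"
  then obtain X Y where XY: "set_direct_factorization G X Y"
    and ntX: "\<And>z. z \<in> center G \<Longrightarrow> X \<noteq> {z}"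
    and ntY: "\<And>z. z \<in> center G \<Longrightarrow> Y \<noteq> {z}"
    by (auto simp: nontrivial_set_direct_factorization_def)
  interpret group G
    using assms by (simp add: is_simple_def)
  have X: "normal_subset X G" "X \<noteq> {}" "X \<subseteq> carrier G"
    and Y: "normal_subset Y G" "Y \<noteq> {}" "Y \<subseteq> carrier G"
    using XY by (auto simp: set_direct_factorization_def normal_subset_def)
  note comm = set_direct_factorization_commute[OF XY]
  have "\<one>\<^bsub>G\<^esub> \<in> center G"
    by (simp add: center_def)
  \<comment> \<open>Since \<open>\<one>\<close> is central, non-triviality rules out the alternative
    \<open>{\<one>}\<close> for either factor.\<close>
  then have X_central: "X \<subseteq> center G" and Y_central: "Y \<subseteq> center G"
    using is_simple_central_or_trivial[OF assms X(1) Y(3,2)]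
      is_simple_central_or_trivial[OF assms Y(1) X(3,2)] comm ntX ntY by metis+
  have "g \<otimes>\<^bsub>G\<^esub> h = h \<otimes>\<^bsub>G\<^esub> g" if g: "g \<in> carrier G" and h: "h \<in> carrier G" for g h
  proof -
    have "g \<in> (\<lambda>(x, y). x \<otimes>\<^bsub>G\<^esub> y) ` (X \<times> Y)"
      using bij_betw_imp_surj_on[OF bij_betw_set_direct_factorization[OF XY]] g by simp
    then obtain x y where xy: "x \<in> X" "y \<in> Y" "g = x \<otimes>\<^bsub>G\<^esub> y"
      by auto
    then have "x \<in> carrier G" "y \<in> carrier G"
      "x \<otimes>\<^bsub>G\<^esub> h = h \<otimes>\<^bsub>G\<^esub> x" "y \<otimes>\<^bsub>G\<^esub> h = h \<otimes>\<^bsub>G\<^esub> y"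
      using X_central Y_central h by (auto simp: center_def)
    then show ?thesis
      unfolding xy(3) using h by (metis m_assoc)
  qed
  then interpret comm_group G
    by (rule group_comm_groupI)
  have "prime (card X * card Y)"
    using prime_order_if_is_simple[OF assms] order_eq_set_direct_factorization[OF XY] by simp
  then have "card X = 1 \<or> card Y = 1"
    by (metis prime_product)
  \<comment> \<open>A factor with one element is a singleton of a central element, which
    non-triviality forbids.\<close>
  then show False
    using X_central Y_central ntX ntY by (metis card_1_singletonE insert_subset)
qed

end
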